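(* Let $Y$ be a simple positively weighted graph on $n$ vertices, and consider the connected double cone $K_2\vee Y$ in which the edge joining the two apexes has weight one. Then proper Laplacian fractional revival does not occur between the two apexes of $K_2\vee Y$.
   Context: The join $X\vee Y$ of two weighted graphs is obtained from their disjoint union by joining every vertex of $X$ to every vertex of $Y$ by an edge of weight one. In $K_2\vee Y$, the two vertices of $K_2$ (which are adjacent to each other) are the apexes. The Laplacian is $L=D-A$, where $A$ is the weighted adjacency matrix and $D$ the diagonal matrix of weighted degrees. $U(t)=e^{itL}$ and $\mathbf e_a$ is the standard basis vector of vertex $a$. $(\alpha,\beta)$-fractional revival occurs between $u$ and $v$ at time $\tau$ if $U(\tau)\mathbf e_u=\alpha\mathbf e_u+\beta\mathbf e_v$ for some $\alpha,\beta\in\mathbb C$; it is proper if $\beta\neq 0$. *)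

theory Defs
  imports "HOL-Analysis.Analysis"
begin

text \<open>
  A graph has the whole finite type \<open>'a\<close> as its vertex set. The value of \<open>wt\<close> on
  non-adjacent pairs carries no meaning; \<open>adjacency\<close> ignores it.
\<close>

record 'a wgraph =
  adj :: "'a \<Rightarrow> 'a \<Rightarrow> bool"
  wt :: "'a \<Rightarrow> 'a \<Rightarrow> real"

definition simple_graph :: "'a wgraph \<Rightarrow> bool" where
  "simple_graph X \<longleftrightarrow>
     (\<forall>u. \<not> adj X u u) \<and> (\<forall>u v. adj X u v \<longrightarrow> adj X v u \<and> wt X v u = wt X u v)"

definition positively_weighted :: "'a wgraph \<Rightarrow> bool" where
  "positively_weighted X \<longleftrightarrow> (\<forall>u v. adj X u v \<longrightarrow> wt X u v > 0)"

definition K2 :: "bool wgraph" where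
  "K2 = \<lparr>adj = (\<lambda>a b. a \<noteq> b), wt = (\<lambda>_ _. 1)\<rparr>"

definition join :: "'a wgraph \<Rightarrow> 'b wgraph \<Rightarrow> ('a + 'b) wgraph" where
  "join X Y =
     \<lparr>adj = (\<lambda>p q. case (p, q) of
               (Inl u, Inl v) \<Rightarrow> adj X u v
             | (Inr u, Inr v) \<Rightarrow> adj Y u v
             | _ \<Rightarrow> True),
      wt = (\<lambda>p q. case (p, q) of
               (Inl u, Inl v) \<Rightarrow> wt X u v
             | (Inr u, Inr v) \<Rightarrow> wt Y u v
             | _ \<Rightarrow> 1)\<rparr>"

definition adjacency :: "'a::finite wgraph \<Rightarrow> real^'a^'a" where
  "adjacency X = (\<chi> u v. if adj X u v then wt X u v else 0)"

definition degree_matrix :: "'a::finite wgraph \<Rightarrow> real^'a^'a" where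
  "degree_matrix X = (\<chi> u v. if u = v then (\<Sum>w\<in>UNIV. adjacency X $ u $ w) else 0)"

definition laplacian :: "'a::finite wgraph \<Rightarrow> real^'a^'a" where
  "laplacian X = degree_matrix X - adjacency X"

text \<open>
  The product of the type \<open>complex^'a^'a\<close> is componentwise, so the library's power and
  \<open>exp\<close> cannot be used for matrices.
\<close>

primrec matpow :: "complex^'a^'a \<Rightarrow> nat \<Rightarrow> complex^'a^'a" where
  "matpow M 0 = mat 1"
| "matpow M (Suc k) = M ** matpow M k"

definition matexp :: "complex^'a^'a \<Rightarrow> complex^'a^'a" where
  "matexp M = (\<Sum>k. (1 / fact k) *\<^sub>R matpow M k)"

lemma norm_matpow_le: "norm (matpow M k $ i $ j) \<le> (\<Sum>p\<in>UNIV. \<Sum>q\<in>UNIV. norm (M $ p $ q)) ^ k"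
proof (induction k arbitrary: i j)
  case 0
  show ?case by (simp add: mat_def)
next
  case (Suc k)
  let ?c = "\<Sum>p\<in>UNIV. \<Sum>q\<in>UNIV. norm (M $ p $ q)"
  have "norm (matpow M (Suc k) $ i $ j) \<le> (\<Sum>q\<in>UNIV. norm (M $ i $ q * matpow M k $ q $ j))"
    by (simp add: matrix_matrix_mult_def norm_sum)
  also have "\<dots> \<le> (\<Sum>q\<in>UNIV. norm (M $ i $ q) * ?c ^ k)"
    by (intro sum_mono) (simp add: norm_mult mult_left_mono Suc.IH)
  also have "\<dots> = (\<Sum>q\<in>UNIV. norm (M $ i $ q)) * ?c ^ k"
    by (simp add: sum_distrib_right)
  also have "\<dots> \<le> ?c * ?c ^ k"
    by (intro mult_right_mono member_le_sum[where f = "\<lambda>p. \<Sum>q\<in>UNIV. norm (M $ p $ q)"])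
       (auto intro!: sum_nonneg zero_le_power)
  finally show ?case by simp
qed

lemma summable_matexp: "summable (\<lambda>k. (1 / fact k) *\<^sub>R matpow M k)"
proof -
  let ?c = "\<Sum>p\<in>UNIV. \<Sum>q\<in>UNIV. norm (M $ p $ q)"
  let ?N = "\<Sum>p\<in>(UNIV::'a set). \<Sum>q\<in>(UNIV::'a set). (1::real)"
  have norm_le: "norm (matpow M k) \<le> ?N * ?c ^ k" for k
  proof -
    have "norm (matpow M k) \<le> (\<Sum>p\<in>UNIV. norm (matpow M k $ p))"
      unfolding norm_vec_def by (rule L2_set_le_sum) simp
    also have "\<dots> \<le> (\<Sum>p\<in>UNIV. \<Sum>q\<in>UNIV. norm (matpow M k $ p $ q))"
      unfolding norm_vec_def[where 'a = complex] by (intro sum_mono L2_set_le_sum) simp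
    also have "\<dots> \<le> (\<Sum>p\<in>(UNIV::'a set). \<Sum>q\<in>(UNIV::'a set). ?c ^ k)"
      by (intro sum_mono norm_matpow_le)
    finally show ?thesis by simp
  qed
  show ?thesis
  proof (rule summable_comparison_test')
    show "summable (\<lambda>k. ?N * (inverse (fact k) * ?c ^ k))"
      by (intro summable_mult summable_exp)
    show "norm ((1 / fact k) *\<^sub>R matpow M k) \<le> ?N * (inverse (fact k) * ?c ^ k)" if "k \<ge> 0" for k
      using mult_left_mono[OF norm_le[of k], of "inverse (fact k)"]
      by (simp add: field_simps)
  qed
qed

definition transition :: "'a::finite wgraph \<Rightarrow> real \<Rightarrow> complex^'a^'a" where
  "transition X t = matexp (\<chi> u v. \<i> * of_real t * of_real (laplacian X $ u $ v))"

definition laplacian_fractional_revival ::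
  "'a::finite wgraph \<Rightarrow> complex \<Rightarrow> complex \<Rightarrow> 'a \<Rightarrow> 'a \<Rightarrow> real \<Rightarrow> bool" where
  "laplacian_fractional_revival X \<alpha> \<beta> u v \<tau> \<longleftrightarrow>
     transition X \<tau> *v axis u 1 = \<alpha> *s axis u 1 + \<beta> *s axis v 1"

definition proper_laplacian_fractional_revival ::
  "'a::finite wgraph \<Rightarrow> 'a \<Rightarrow> 'a \<Rightarrow> real \<Rightarrow> bool" where
  "proper_laplacian_fractional_revival X u v \<tau> \<longleftrightarrow>
     (\<exists>\<alpha> \<beta>. laplacian_fractional_revival X \<alpha> \<beta> u v \<tau> \<and> \<beta> \<noteq> 0)"

end

theory Submission
  imports Defs
begin

text \<open>
  An apex \<open>u\<close> of the double cone is joined to every other vertex by an edge of weight one, so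
  column \<open>u\<close> of the Laplacian is constant off the diagonal, and the Laplacian annihilates the
  constant vectors. Hence it preserves the span of \<open>\<^bold>e\<^sub>u\<close> and the all-ones vector, that is, the
  vectors constant away from \<open>u\<close>, and so does \<open>U(t)\<close>. Fractional revival makes the entry of
  \<open>U(\<tau>) \<^bold>e\<^sub>u\<close> at a vertex of \<open>Y\<close> vanish; the entry \<open>\<beta>\<close> at the other apex is equal to it.
\<close>

lemma matpow_column_constant:
  fixes M :: "complex^'a^'a"
  assumes rows: "\<And>v. (\<Sum>q\<in>UNIV. M $ v $ q) = 0"
    and column: "\<And>v. v \<noteq> u \<Longrightarrow> M $ v $ u = c"
    and "v \<noteq> u" "w \<noteq> u"
  shows "matpow M k $ v $ u = matpow M k $ w $ u"
  using assms(3,4)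
proof (induction k arbitrary: v w)
  case 0
  then show ?case by (simp add: mat_def)
next
  case (Suc k)
  define P where "P q = matpow M k $ q $ u" for q
  \<comment> \<open>As a vector, \<open>P\<close> is \<open>P v\<close> times the all-ones vector
    plus a multiple of the basis vector at \<open>u\<close>. \<open>M\<close> kills the first part
    by \<open>rows\<close> and sends the second to a multiple of its column
    \<open>u\<close>.\<close>
  have P: "P q = P v + (if q = u then P u - P v else 0)" for q
    using Suc.IH[of q v] Suc.prems(1) by (simp add: P_def)
  have "matpow M (Suc k) $ x $ u = c * (P u - P v)" if "x \<noteq> u" for x
  proof -
    have "matpow M (Suc k) $ x $ u = (\<Sum>q\<in>UNIV. M $ x $ q * P q)"
      by (simp add: matrix_matrix_mult_def P_def)
    also have "\<dots> = (\<Sum>q\<in>UNIV. M $ x $ q * P v + (if q = u then M $ x $ q * (P u - P v) else 0))"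
      by (rule sum.cong[OF refl], subst P) (simp add: algebra_simps)
    also have "\<dots> = (\<Sum>q\<in>UNIV. M $ x $ q) * P v + M $ x $ u * (P u - P v)"
      by (simp add: sum.distrib sum_distrib_right)
    finally show ?thesis
      using that by (simp add: rows column)
  qed
  then show ?case
    using Suc.prems by simp
qed

text \<open>Taking an entry is bounded linear, so it passes through the convergent series; equal
  entries of all powers then give equal entries of the exponential.\<close>

lemma matexp_nth: "matexp M $ v $ u = (\<Sum>k. (1 / fact k) *\<^sub>R matpow M k $ v $ u)"
proof -
  have "bounded_linear (\<lambda>A :: complex^'a^'a. A $ v $ u)"
    by (intro bounded_linear_compose[OF bounded_linear_vec_nth bounded_linear_vec_nth])
  from bounded_linear.suminf[OF this summable_matexp[of M]] show ?thesis
    by (simp add: matexp_def)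
qed

lemma laplacian_row_sum: "(\<Sum>v\<in>UNIV. laplacian X $ u $ v) = 0"
  by (simp add: laplacian_def degree_matrix_def sum_subtractf)

lemma transition_column_constant:
  assumes dominating: "\<And>v. v \<noteq> u \<Longrightarrow> adj X v u \<and> wt X v u = 1"
    and "v \<noteq> u" "w \<noteq> u"
  shows "transition X t $ v $ u = transition X t $ w $ u"
proof -
  define M :: "complex^'a^'a" where
    "M = (\<chi> u v. \<i> * of_real t * of_real (laplacian X $ u $ v))"
  have "(\<Sum>q\<in>UNIV. M $ x $ q) = 0" for x
    by (simp add: M_def flip: sum_distrib_left of_real_sum) (simp add: laplacian_row_sum)
  moreover have "M $ x $ u = - (\<i> * of_real t)" if "x \<noteq> u" for x
    using dominating[OF that] that
    by (simp add: M_def laplacian_def degree_matrix_def adjacency_def)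
  ultimately have "matpow M k $ v $ u = matpow M k $ w $ u" for k
    using assms(2,3) by (rule matpow_column_constant)
  then show ?thesis
    by (simp add: transition_def matexp_nth flip: M_def)
qed

theorem theorem6p5:
  fixes Y :: "'n::finite wgraph" and a b :: bool
  assumes "simple_graph Y" and "positively_weighted Y" and "a \<noteq> b"
  shows "\<not> (\<exists>\<tau>. proper_laplacian_fractional_revival (join K2 Y) (Inl a) (Inl b) \<tau>)"
proof
  let ?X = "join K2 Y"
  assume "\<exists>\<tau>. proper_laplacian_fractional_revival ?X (Inl a) (Inl b) \<tau>"
  then obtain \<tau> \<alpha> \<beta> where "\<beta> \<noteq> 0" and revival:
    "transition ?X \<tau> *v axis (Inl a) 1 = \<alpha> *s axis (Inl a) 1 + \<beta> *s axis (Inl b) 1"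
    by (auto simp: proper_laplacian_fractional_revival_def laplacian_fractional_revival_def)
  have entry: "transition ?X \<tau> $ v $ Inl a =
      \<alpha> * axis (Inl a) 1 $ v + \<beta> * axis (Inl b) 1 $ v" for v
    using arg_cong[OF revival, of "\<lambda>x. x $ v"]
    by (simp add: matrix_vector_mult_def axis_def if_distrib cong: if_cong)
  have "adj ?X v (Inl a) \<and> wt ?X v (Inl a) = 1" if "v \<noteq> Inl a" for v
    using that by (cases v) (auto simp: join_def K2_def)
  \<comment> \<open>\<open>Inr undefined\<close> is an arbitrary vertex of \<open>Y\<close>,
    available because types are nonempty. It is neither apex, so \<open>entry\<close> gives 0 there
    and \<beta> at \<open>Inl b\<close>.\<close>
  then have "transition ?X \<tau> $ Inl b $ Inl a = transition ?X \<tau> $ Inr undefined $ Inl a"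
    using assms(3) by (intro transition_column_constant) auto
  then have "\<beta> = 0"
    unfolding entry using assms(3) by (simp add: axis_def)
  with \<open>\<beta> \<noteq> 0\<close> show False ..
qed

end
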